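(* Let $E$ be a normed space, let $1\le p\le q<+\infty$ and let $0<\alpha\le\frac pq\le1$. If $f\colon E\to E$ is Hölder continuous on bounded sets with exponent $\alpha$ and there exists a closed ball $\overline{B}_E(0,R)$, where $R>0$, on which $f$ satisfies the Hölder condition with exponent $\frac pq$ (that is, there is $\Lambda\ge0$ with $\|f(u)-f(w)\|\le\Lambda\|u-w\|^{\frac pq}$ for all $u,w\in\overline{B}_E(0,R)$), then the composition operator $C_f$ maps $l^p(E)$ into $bv_q(E)$ and is Hölder continuous on bounded sets with exponent $\alpha$.
   Context: $E$ is a normed space over $\mathbb R$ or $\mathbb C$ with norm $\|\cdot\|$, and $\overline{B}_E(0,R)$ is its closed ball with center $0$ and radius $R$. For a map $f\colon E\to E$, the composition operator $C_f$ assigns to a sequence $x\colon\mathbb N\to E$ the sequence $C_f(x)$ with $C_f(x)(n)=f(x(n))$ for all $n\in\mathbb N$. $l^p(E)$ is the space of sequences $x\colon\mathbb N\to E$ with $\|x\|_{l^p}=\bigl(\sum_{n=1}^\infty\|x(n)\|^p\bigr)^{1/p}<+\infty$. $bv_q(E)$ is the space of all sequences $x\colon\mathbb N\to E$ with $\sum_{n=1}^\infty\|x(n+1)-x(n)\|^q<+\infty$, with norm $\|x\|_{bv_q}=\|x(1)\|+\bigl(\sum_{n=1}^\infty\|x(n+1)-x(n)\|^q\bigr)^{1/q}$. A map $F\colon X\to Y$ between normed spaces is Hölder continuous on bounded sets with exponent $\alpha\in(0,1]$ if for every $r>0$ there exists $L_r\ge0$ such that $\|F(x)-F(y)\|_Y\le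 L_r\|x-y\|_X^\alpha$ for all $x,y$ in the closed ball of $X$ with center $0$ and radius $r$. *)

theory Defs
  imports "HOL-Analysis.Elementary_Metric_Spaces"
begin

(* Sequences are functions on nat, so the first term is x 0. *)

definition lp_space :: "real \<Rightarrow> (nat \<Rightarrow> 'a::real_normed_vector) set" where
  "lp_space p = {x. summable (\<lambda>n. norm (x n) powr p)}"

definition lp_norm :: "real \<Rightarrow> (nat \<Rightarrow> 'a::real_normed_vector) \<Rightarrow> real" where
  "lp_norm p x = (\<Sum>n. norm (x n) powr p) powr (1 / p)"

definition bv_space :: "real \<Rightarrow> (nat \<Rightarrow> 'a::real_normed_vector) set" where
  "bv_space q = {x. summable (\<lambda>n. norm (x (Suc n) - x n) powr q)}"

definition bv_norm :: "real \<Rightarrow> (nat \<Rightarrow> 'a::real_normed_vector) \<Rightarrow> real" where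
  "bv_norm q x = norm (x 0) + (\<Sum>n. norm (x (Suc n) - x n) powr q) powr (1 / q)"

definition composition_op :: "('a \<Rightarrow> 'b) \<Rightarrow> (nat \<Rightarrow> 'a) \<Rightarrow> nat \<Rightarrow> 'b" where
  "composition_op f x = (\<lambda>n. f (x n))"

(* The domain is the normed space with carrier X and norm nX, the codomain carries the norm nY.
   That F maps X into the carrier of the codomain is not part of this definition.
   Differences of sequences are pointwise.
   For \<alpha> > 0 the convention 0 powr \<alpha> = 0 is the usual one. *)
definition hoelder_on_bounded ::
  "'a::minus set \<Rightarrow> ('a \<Rightarrow> real) \<Rightarrow> ('b::minus \<Rightarrow> real) \<Rightarrow> real \<Rightarrow> ('a \<Rightarrow> 'b) \<Rightarrow> bool" where
  "hoelder_on_bounded X nX nY \<alpha> F \<longleftrightarrow>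
     (\<forall>r>0. \<exists>L\<ge>0. \<forall>x\<in>X. \<forall>y\<in>X. nX x \<le> r \<longrightarrow> nX y \<le> r \<longrightarrow>
        nY (F x - F y) \<le> L * nX (x - y) powr \<alpha>)"

end

(* The operator norm of the difference operator on l^q is finite, so it suffices to bound the l^q norm
   of C_f x - C_f y on bounded sets of l^p; membership in bv_q is the case y = 0. Where both x n and
   y n lie in the small ball, the exponent p/q turns norm (f (x n) - f (y n)) powr q into a multiple of
   norm (x n - y n) powr p, which is summable. All other indices satisfy
   R powr p <= norm (x n) powr p + norm (y n) powr p, and this weight, which is summable with sum at
   most 2 r powr p, multiplies the uniform bound given by the Hoelder condition on the ball of radius r. *)
theory Submission imports Defs
begin

text \<open>The norm of the difference is at most twice the larger norm, whose \<open>p\<close>-th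
  power is one of the two summands. Only finiteness of constants matters below, so this crude bound
  stands in for the Minkowski inequality.\<close>

lemma norm_diff_powr_le:
  fixes a b :: "'a::real_normed_vector"
  assumes "0 \<le> p"
  shows "norm (a - b) powr p \<le> 2 powr p * (norm a powr p + norm b powr p)"
proof -
  have "norm (a - b) \<le> 2 * max (norm a) (norm b)"
    using norm_triangle_ineq4[of a b] by linarith
  then have "norm (a - b) powr p \<le> (2 * max (norm a) (norm b)) powr p"
    using assms by (intro powr_mono2) auto
  also have "\<dots> = 2 powr p * max (norm a) (norm b) powr p"
    by (simp add: powr_mult)
  also have "\<dots> \<le> 2 powr p * (norm a powr p + norm b powr p)"
    by (intro mult_left_mono) (auto simp: max_def)
  finally show ?thesis .
qed

lemma lp_norm_nonneg: "0 \<le> lp_norm p x"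
  by (simp add: lp_norm_def)

lemma lp_norm_powr:
  assumes "0 < p" "x \<in> lp_space p"
  shows "lp_norm p x powr p = (\<Sum>n. norm (x n) powr p)"
  using assms by (simp add: lp_norm_def lp_space_def powr_powr suminf_nonneg)

lemma norm_le_lp_norm:
  assumes "0 < p" "x \<in> lp_space p"
  shows "norm (x n) \<le> lp_norm p x"
proof -
  have "norm (x n) powr p \<le> (\<Sum>n. norm (x n) powr p)"
    using sum_le_suminf[of "\<lambda>n. norm (x n) powr p" "{n}"] assms by (simp add: lp_space_def)
  then have "(norm (x n) powr p) powr (1 / p) \<le> lp_norm p x"
    using assms unfolding lp_norm_def by (intro powr_mono2) auto
  then show ?thesis
    using assms by (simp add: powr_powr)
qed

lemma suminf_powr_le:
  assumes "0 < p" "x \<in> lp_space p" "lp_norm p x \<le> r"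
  shows "(\<Sum>n. norm (x n) powr p) \<le> r powr p"
  using lp_norm_powr[OF assms(1,2)] assms by (metis less_imp_le lp_norm_nonneg powr_mono2)

text \<open>Comparison test with a summable majorant \<open>g\<close>; the bound \<open>T\<close> on
  its sum then passes through the monotone \<open>p\<close>-th root.\<close>

lemma lp_spaceI_le:
  assumes "0 < p" "\<And>n. norm (x n) powr p \<le> g n" "summable g" "suminf g \<le> T"
  shows "x \<in> lp_space p" "lp_norm p x \<le> T powr (1 / p)"
proof -
  have s: "summable (\<lambda>n. norm (x n) powr p)"
    by (rule summable_comparison_test'[OF assms(3), of 0]) (simp add: assms(2))
  then show "x \<in> lp_space p"
    by (simp add: lp_space_def)
  have "(\<Sum>n. norm (x n) powr p) \<le> T"
    using suminf_le[OF assms(2) s assms(3)] assms(4) by linarith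
  then show "lp_norm p x \<le> T powr (1 / p)"
    using assms(1) unfolding lp_norm_def
    by (intro powr_mono2) (auto intro: suminf_nonneg s)
qed

lemma lp_space_diff:
  fixes x y :: "nat \<Rightarrow> 'a::real_normed_vector"
  assumes "0 < p" "x \<in> lp_space p" "y \<in> lp_space p" "lp_norm p x \<le> r" "lp_norm p y \<le> r"
  shows "x - y \<in> lp_space p" "lp_norm p (x - y) \<le> (2 powr p * (2 * r powr p)) powr (1 / p)"
proof -
  let ?g = "\<lambda>n. 2 powr p * (norm (x n) powr p + norm (y n) powr p)"
  have s: "summable (\<lambda>n. norm (x n) powr p)" "summable (\<lambda>n. norm (y n) powr p)"
    using assms by (simp_all add: lp_space_def)
  have le: "norm ((x - y) n) powr p \<le> ?g n" for n
    using norm_diff_powr_le[of p "x n" "y n"] assms(1) by simp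
  have g: "summable ?g"
    by (intro summable_mult summable_add s)
  have "suminf ?g = 2 powr p * ((\<Sum>n. norm (x n) powr p) + (\<Sum>n. norm (y n) powr p))"
    by (simp add: suminf_mult suminf_add s summable_add)
  also have "\<dots> \<le> 2 powr p * (2 * r powr p)"
    using suminf_powr_le[OF assms(1,2,4)] suminf_powr_le[OF assms(1,3,5)]
    by (intro mult_left_mono) auto
  finally have T: "suminf ?g \<le> 2 powr p * (2 * r powr p)" .
  show "x - y \<in> lp_space p" "lp_norm p (x - y) \<le> (2 powr p * (2 * r powr p)) powr (1 / p)"
    using lp_spaceI_le[where x = "x - y", OF assms(1) le g T] by auto
qed

text \<open>Consecutive differences are the shifted sequence minus \<open>h\<close>, and shifting
  does not increase the norm. In the constant, 1 accounts for the initial term and the rest for the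
  differences.\<close>

lemma lp_space_imp_bv_space:
  fixes h :: "nat \<Rightarrow> 'a::real_normed_vector"
  assumes "0 < q" "h \<in> lp_space q"
  shows "h \<in> bv_space q"
    and "bv_norm q h \<le> (1 + (2 powr q * 2) powr (1 / q)) * lp_norm q h"
proof -
  have s: "summable (\<lambda>n. norm (h n) powr q)"
    using assms by (simp add: lp_space_def)
  have s': "(\<lambda>n. h (Suc n)) \<in> lp_space q"
    using s by (simp add: lp_space_def summable_Suc_iff[of "\<lambda>n. norm (h n) powr q"])
  have "(\<Sum>n. norm (h (Suc n)) powr q) \<le> (\<Sum>n. norm (h n) powr q)"
    using suminf_split_head[OF s] by simp
  then have "lp_norm q (\<lambda>n. h (Suc n)) \<le> lp_norm q h"
    using assms(1) s' unfolding lp_norm_def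
    by (intro powr_mono2) (auto simp: lp_space_def intro: suminf_nonneg)
  \<comment> \<open>The common radius is \<open>lp_norm q h\<close> itself, which makes the bound
    homogeneous in \<open>h\<close>.\<close>
  note d = lp_space_diff[OF assms(1) s' assms(2) this order_refl]
  show "h \<in> bv_space q"
    using d(1) by (simp add: lp_space_def bv_space_def)
  have "(2 powr q * (2 * lp_norm q h powr q)) powr (1 / q)
      = (2 powr q * 2) powr (1 / q) * lp_norm q h"
    using assms(1) lp_norm_nonneg[of q h]
    by (simp add: powr_mult powr_powr flip: mult.assoc)
  with d(2) have "(\<Sum>n. norm (h (Suc n) - h n) powr q) powr (1 / q)
      \<le> (2 powr q * 2) powr (1 / q) * lp_norm q h"
    by (simp add: lp_norm_def)
  then show "bv_norm q h \<le> (1 + (2 powr q * 2) powr (1 / q)) * lp_norm q h"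
    using norm_le_lp_norm[OF assms, of 0] by (simp add: bv_norm_def algebra_simps)
qed

lemma composition_op_lp_bound:
  fixes f :: "'a::real_normed_vector \<Rightarrow> 'b::real_normed_vector"
  assumes "0 < p" "0 < q" "0 < \<alpha>" "\<alpha> \<le> p / q" "0 < r" "0 < R" "0 \<le> \<Lambda>" "0 \<le> L"
    and L: "\<And>u w. norm u \<le> r \<Longrightarrow> norm w \<le> r \<Longrightarrow> norm (f u - f w) \<le> L * norm (u - w) powr \<alpha>"
    and \<Lambda>: "\<And>u w. norm u \<le> R \<Longrightarrow> norm w \<le> R \<Longrightarrow>
          norm (f u - f w) \<le> \<Lambda> * norm (u - w) powr (p / q)"
  obtains C where "0 \<le> C"
    and "\<And>x y. \<lbrakk>x \<in> lp_space p; y \<in> lp_space p; lp_norm p x \<le> r; lp_norm p y \<le> r\<rbrakk> \<Longrightarrow>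
          composition_op f x - composition_op f y \<in> lp_space q \<and>
          lp_norm q (composition_op f x - composition_op f y) \<le> C * lp_norm p (x - y) powr \<alpha>"
proof -
  \<comment> \<open>\<open>D\<close> bounds \<open>lp_norm p (x - y)\<close> for all
    \<open>x\<close>, \<open>y\<close> in the ball of radius \<open>r\<close>, so \<open>C\<close>
    can be fixed before \<open>x\<close> and \<open>y\<close>.\<close>
  define D where "D = (2 powr p * (2 * r powr p)) powr (1 / p)"
  \<comment> \<open>This is the \<open>q\<close>-th power of the final constant: the first summand
    comes from indices outside the small ball, the second from those inside.\<close>
  define C where "C = L powr q / R powr p * (2 * r powr p) + \<Lambda> powr q * D powr (p - \<alpha> * q)"
  have C0: "0 \<le> C"
    by (simp add: C_def)
  have \<alpha>q: "\<alpha> * q \<le> p"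
    using assms by (simp add: field_simps)
  have "composition_op f x - composition_op f y \<in> lp_space q \<and>
        lp_norm q (composition_op f x - composition_op f y) \<le> C powr (1 / q) * lp_norm p (x - y) powr \<alpha>"
    if xy: "x \<in> lp_space p" "y \<in> lp_space p" "lp_norm p x \<le> r" "lp_norm p y \<le> r" for x y
  proof -
    define d where "d = lp_norm p (x - y)"
    have d0: "0 \<le> d"
      by (simp add: d_def lp_norm_nonneg)
    note diff = lp_space_diff[OF assms(1) xy]
    have dD: "d \<le> D"
      using diff(2) by (simp add: d_def D_def)
    \<comment> \<open>Chosen so that \<open>A * R powr p\<close> equals
      \<open>(L * d powr \<alpha>) powr q\<close>, the uniform bound for the indices outside the
      small ball.\<close>
    define A where "A = L powr q * d powr (\<alpha> * q) / R powr p"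
    have A0: "0 \<le> A"
      by (simp add: A_def)
    \<comment> \<open>Adding the majorants of both cases avoids splitting the index set; each case
      discards the other, nonnegative summand.\<close>
    let ?g = "\<lambda>n. A * (norm (x n) powr p + norm (y n) powr p) + \<Lambda> powr q * norm (x n - y n) powr p"
    have s: "summable (\<lambda>n. norm (x n) powr p)" "summable (\<lambda>n. norm (y n) powr p)"
      "summable (\<lambda>n. norm (x n - y n) powr p)"
      using xy diff(1) by (simp_all add: lp_space_def)
    have le: "norm ((composition_op f x - composition_op f y) n) powr q \<le> ?g n" for n
    proof (cases "norm (x n) \<le> R \<and> norm (y n) \<le> R")
      case True
      then have "norm (f (x n) - f (y n)) powr q \<le> (\<Lambda> * norm (x n - y n) powr (p / q)) powr q"
        using \<Lambda> assms(2) by (intro powr_mono2) auto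
      also have "\<dots> = \<Lambda> powr q * norm (x n - y n) powr p"
        using assms(2,7) by (simp add: powr_mult powr_powr)
      finally show ?thesis
        using A0 by (simp add: composition_op_def add_increasing)
    next
      case False
      have le_r: "norm (x n) \<le> r" "norm (y n) \<le> r"
        using norm_le_lp_norm[OF assms(1) xy(1)] norm_le_lp_norm[OF assms(1) xy(2)] xy(3,4)
        by (meson order_trans)+
      \<comment> \<open>Every term is at most the whole norm, so the estimate through
        \<open>L\<close> becomes independent of \<open>n\<close>.\<close>
      have "norm (x n - y n) \<le> d"
        using norm_le_lp_norm[OF assms(1) diff(1), of n] by (simp add: d_def)
      then have "norm (x n - y n) powr \<alpha> \<le> d powr \<alpha>"
        using assms(3) by (intro powr_mono2) auto
      with L[OF le_r] assms(8) have "norm (f (x n) - f (y n)) \<le> L * d powr \<alpha>"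
        by (meson mult_left_mono order_trans)
      then have "norm (f (x n) - f (y n)) powr q \<le> (L * d powr \<alpha>) powr q"
        using assms(2) by (intro powr_mono2) auto
      also have "\<dots> = A * R powr p"
        using assms(6,8) by (simp add: A_def powr_mult powr_powr)
      also have "\<dots> \<le> A * (norm (x n) powr p + norm (y n) powr p)"
      proof (intro mult_left_mono A0)
        have "R powr p \<le> norm (x n) powr p \<or> R powr p \<le> norm (y n) powr p"
          using False assms(1,6) by (auto intro!: powr_mono2)
        then show "R powr p \<le> norm (x n) powr p + norm (y n) powr p"
          by (smt (verit) powr_ge_zero)
      qed
      finally show ?thesis
        by (simp add: composition_op_def add_increasing2)
    qed
    have g: "summable ?g"
      by (intro summable_mult summable_add s)
    have "suminf ?g = A * ((\<Sum>n. norm (x n) powr p) + (\<Sum>n. norm (y n) powr p))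
        + \<Lambda> powr q * (\<Sum>n. norm (x n - y n) powr p)"
      by (simp add: suminf_mult summable_mult summable_add s flip: suminf_add)
    also have "\<dots> \<le> A * (2 * r powr p) + \<Lambda> powr q * d powr p"
      using suminf_powr_le[OF assms(1) xy(1,3)] suminf_powr_le[OF assms(1) xy(2,4)]
        lp_norm_powr[OF assms(1) diff(1)]
      by (intro add_mono mult_left_mono A0) (auto simp: d_def)
    also have "\<dots> \<le> A * (2 * r powr p) + \<Lambda> powr q * (D powr (p - \<alpha> * q) * d powr (\<alpha> * q))"
    proof -
      \<comment> \<open>The surplus power \<open>p - \<alpha> * q\<close>, nonnegative by
        \<open>\<alpha>q\<close>, is absorbed into \<open>D\<close>, leaving the exponent
        \<open>\<alpha> * q\<close> that the first summand has. For \<open>d = 0\<close> both sides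
        vanish, since \<open>0 powr z = 0\<close> for every \<open>z\<close>.\<close>
      have "d powr p = d powr (p - \<alpha> * q) * d powr (\<alpha> * q)"
        by (simp flip: powr_add)
      also have "\<dots> \<le> D powr (p - \<alpha> * q) * d powr (\<alpha> * q)"
        using d0 dD \<alpha>q by (intro mult_right_mono powr_mono2) auto
      finally show ?thesis
        by (intro add_left_mono mult_left_mono) auto
    qed
    also have "\<dots> = C * d powr (\<alpha> * q)"
      by (simp add: A_def C_def algebra_simps)
    finally have T: "suminf ?g \<le> C * d powr (\<alpha> * q)" .
    have "(C * d powr (\<alpha> * q)) powr (1 / q) = C powr (1 / q) * d powr \<alpha>"
      using C0 assms(2) by (simp add: powr_mult powr_powr)
    then show ?thesis
      using lp_spaceI_le[where x = "composition_op f x - composition_op f y", OF assms(2) le g T]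
      by (simp add: d_def)
  qed
  then show thesis
    using that[of "C powr (1 / q)"] by simp
qed

theorem theorem32:
  fixes f :: "'a::real_normed_vector \<Rightarrow> 'a" and p q \<alpha> :: real
  assumes "1 \<le> p" and "p \<le> q"
    and "0 < \<alpha>" and "\<alpha> \<le> p / q"
    and "hoelder_on_bounded UNIV norm norm \<alpha> f"
    and "\<exists>R>0. \<exists>\<Lambda>\<ge>0. \<forall>u\<in>cball 0 R. \<forall>w\<in>cball 0 R.
           norm (f u - f w) \<le> \<Lambda> * norm (u - w) powr (p / q)"
  shows "composition_op f ` lp_space p \<subseteq> bv_space q \<and>
         hoelder_on_bounded (lp_space p) (lp_norm p) (bv_norm q) \<alpha> (composition_op f)"
proof -
  have pq: "0 < p" "0 < q"
    using assms(1,2) by auto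
  obtain R \<Lambda> where R: "0 < R" "0 \<le> \<Lambda>"
    and \<Lambda>: "\<And>u w. norm u \<le> R \<Longrightarrow> norm w \<le> R \<Longrightarrow>
      norm (f u - f w) \<le> \<Lambda> * norm (u - w) powr (p / q)"
    using assms(6) by auto
  have bound: "\<exists>C\<ge>0. \<forall>x\<in>lp_space p. \<forall>y\<in>lp_space p. lp_norm p x \<le> r \<longrightarrow> lp_norm p y \<le> r \<longrightarrow>
      composition_op f x - composition_op f y \<in> lp_space q \<and>
      lp_norm q (composition_op f x - composition_op f y) \<le> C * lp_norm p (x - y) powr \<alpha>"
    if "0 < r" for r
  proof -
    have "\<exists>L\<ge>0. \<forall>u w. norm u \<le> r \<longrightarrow> norm w \<le> r \<longrightarrow> norm (f u - f w) \<le> L * norm (u - w) powr \<alpha>"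
      using assms(5) that by (simp add: hoelder_on_bounded_def)
    then obtain L where L: "0 \<le> L"
      "\<And>u w. norm u \<le> r \<Longrightarrow> norm w \<le> r \<Longrightarrow> norm (f u - f w) \<le> L * norm (u - w) powr \<alpha>"
      by meson
    show ?thesis
      by (rule composition_op_lp_bound[OF pq assms(3,4) that R L(1) L(2) \<Lambda>]) auto
  qed
  show ?thesis
  proof
    show "composition_op f ` lp_space p \<subseteq> bv_space q"
    proof (rule image_subsetI)
      fix x :: "nat \<Rightarrow> 'a" assume x: "x \<in> lp_space p"
      \<comment> \<open>The image of the zero sequence is constantly \<open>f 0\<close> and need not
        lie in \<open>lp_space q\<close>; only the difference from it does.\<close>
      let ?o = "\<lambda>_::nat. 0::'a"
      have "?o \<in> lp_space p" "lp_norm p ?o = 0"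
        by (simp_all add: lp_space_def lp_norm_def)
      \<comment> \<open>Adding 1 keeps the radius positive even when \<open>x\<close> is
        zero.\<close>
      moreover have "0 < lp_norm p x + 1"
        using lp_norm_nonneg[of p x] by simp
      ultimately have "composition_op f x - composition_op f ?o \<in> lp_space q"
        using bound[of "lp_norm p x + 1"] x by force
      then have "composition_op f x - composition_op f ?o \<in> bv_space q"
        by (rule lp_space_imp_bv_space(1)[OF pq(2)])
      \<comment> \<open>The constant \<open>f 0\<close> cancels in consecutive differences.\<close>
      then show "composition_op f x \<in> bv_space q"
        by (simp add: bv_space_def composition_op_def)
    qed
    show "hoelder_on_bounded (lp_space p) (lp_norm p) (bv_norm q) \<alpha> (composition_op f)"
      unfolding hoelder_on_bounded_def
    proof (intro allI impI)
      fix r :: real assume "0 < r"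
      then obtain C where C: "0 \<le> C"
        "\<And>x y. \<lbrakk>x \<in> lp_space p; y \<in> lp_space p; lp_norm p x \<le> r; lp_norm p y \<le> r\<rbrakk> \<Longrightarrow>
          composition_op f x - composition_op f y \<in> lp_space q \<and>
          lp_norm q (composition_op f x - composition_op f y) \<le> C * lp_norm p (x - y) powr \<alpha>"
        using bound by meson
      \<comment> \<open>The constant of the embedding of \<open>lp_space q\<close> into
        \<open>bv_space q\<close>; multiplied by \<open>C\<close> it gives the required Hoelder
        constant.\<close>
      define K where "K = 1 + (2 powr q * 2) powr (1 / q)"
      have K: "0 \<le> K"
        by (simp add: K_def add_nonneg_nonneg)
      show "\<exists>L\<ge>0. \<forall>x\<in>lp_space p. \<forall>y\<in>lp_space p. lp_norm p x \<le> r \<longrightarrow> lp_norm p y \<le> r \<longrightarrow>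
          bv_norm q (composition_op f x - composition_op f y) \<le> L * lp_norm p (x - y) powr \<alpha>"
      proof (intro exI[of _ "K * C"] conjI ballI impI)
        show "0 \<le> K * C"
          using K C(1) by simp
        fix x y :: "nat \<Rightarrow> 'a"
        assume "x \<in> lp_space p" "y \<in> lp_space p" "lp_norm p x \<le> r" "lp_norm p y \<le> r"
        note h = C(2)[OF this]
        have "bv_norm q (composition_op f x - composition_op f y)
            \<le> K * lp_norm q (composition_op f x - composition_op f y)"
          using lp_space_imp_bv_space(2)[OF pq(2)] h unfolding K_def by blast
        also have "\<dots> \<le> K * (C * lp_norm p (x - y) powr \<alpha>)"
          using h K by (intro mult_left_mono) auto
        finally show "bv_norm q (composition_op f x - composition_op f y)
            \<le> K * C * lp_norm p (x - y) powr \<alpha>"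
          by (simp add: mult.assoc)
      qed
    qed
  qed
qed

end
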